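(* Let $t_n=(-1)^{s_2(n)}$, $h_0=0$, $h_1=1$, and $h_n=t_nh_{n-1}+h_{n-2}$ for $n\ge2$. Let $n\ge 5$ be an integer. Then the regular continued fraction expansion of $|h_n|/|h_{n-1}|$ has the form $[a(n);\varepsilon_1(n),\ldots,\varepsilon_{k_n}(n)]$ where $a(n)\in\{0,1,2,3,4\}$ and $\varepsilon_i(n)\in\{1,2,3\}$ for each $i\in\{1,\ldots,k_n\}$.
   Context: $s_2(n)$ denotes the number of 1's in the binary expansion of $n$; $(t_n)$ is the Prouhet–Thue–Morse sequence. $[a_0;a_1,\ldots,a_k]=a_0+1/[a_1;\ldots,a_k]$ with $[a_0]=a_0$; regular means $a_0\in\mathbb{N}$ and $a_i\in\mathbb{N}_{+}$ for $i\ge1$. *)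

theory Defs
  imports Complex_Main
begin

definition binary_digit_sum :: "nat \<Rightarrow> nat" where
  "binary_digit_sum n = card {k. bit n k}"

definition thue_morse :: "nat \<Rightarrow> int" where
  "thue_morse n = (- 1) ^ binary_digit_sum n"

fun h :: "nat \<Rightarrow> int" where
  "h 0 = 0"
| "h (Suc 0) = 1"
| "h (Suc (Suc n)) = thue_morse (Suc (Suc n)) * h (Suc n) + h n"

text \<open>
  The continued fraction [a0; a1, ..., ak] is represented by its first entry a0
  and the list of the entries a1, ..., ak, which is empty for [a0].
\<close>

fun cfrac :: "nat \<Rightarrow> nat list \<Rightarrow> real" where
  "cfrac a [] = real a"
| "cfrac a (b # bs) = real a + 1 / cfrac b bs"

text \<open>
  Every rational number x > 0 has exactly two such expansions, because
  [a0; ..., ak] = [a0; ..., ak - 1, 1] if ak > 1 or k = 0.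
\<close>

definition regular_cfrac_expansion :: "real \<Rightarrow> nat \<Rightarrow> nat list \<Rightarrow> bool" where
  "regular_cfrac_expansion x a es \<longleftrightarrow> (\<forall>e\<in>set es. e > 0) \<and> cfrac a es = x"

end

theory Submission
  imports Defs
begin

text \<open>
  The ratios \<open>r n = h n / h (n - 1)\<close> satisfy \<open>r n = t n + 1 / r (n - 1)\<close>, so passing from
  \<open>n - 1\<close> to \<open>n\<close> only changes the first few partial quotients of the absolute value of the ratio.
  For \<open>k \<ge> 1\<close> the number \<open>t k * r (16 * k)\<close> is either \<open>[4; V]\<close> or \<open>- [2; V]\<close> with all partial
  quotients of \<open>V\<close> in \<open>{1, 2, 3}\<close>. Since \<open>t (16 * k + j) = t k * t j\<close> for \<open>j < 16\<close>, the next sixteen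
  steps run through one of finitely many explicit computations. These never reach into \<open>V\<close>,
  keep the partial quotients within the bounds, and end in one of the two forms again.
\<close>

section \<open>Continued fractions with bounded partial quotients\<close>

text \<open>A positive rational has two expansions, so the bounds are demanded of every expansion,
  with existence added to exclude vacuity. The leading entry has its own bound: 4 for the ratios, 3
  for tails.\<close>

definition bounded_cfrac :: "nat \<Rightarrow> real \<Rightarrow> bool" where
  "bounded_cfrac c x \<longleftrightarrow> (\<exists>a es. regular_cfrac_expansion x a es) \<and>
    (\<forall>a es. regular_cfrac_expansion x a es \<longrightarrow> a \<le> c \<and> set es \<subseteq> {1, 2, 3})"

lemma cfrac_ge:
  assumes "\<forall>e\<in>set es. e > 0"
  shows "cfrac a es \<ge> real a"
  using assms
proof (induction a es rule: cfrac.induct)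
  case (2 a b bs)
  then have "cfrac b bs \<ge> real b" by simp
  then show ?case by (simp add: order_trans[OF of_nat_0_le_iff])
qed simp

text \<open>This serves to recognise the second expansion \<open>[a - 1; 1]\<close> of an integer
  \<open>a\<close>; the condition \<open>a > 0\<close> excludes \<open>[0; 1]\<close>.\<close>

lemma cfrac_eq_1_iff:
  assumes "\<forall>e\<in>set es. e > 0" "a > 0"
  shows "cfrac a es = 1 \<longleftrightarrow> a = 1 \<and> es = []"
proof (cases es)
  case (Cons b bs)
  with assms have "cfrac b bs \<ge> real b" "b > 0" by (auto intro: cfrac_ge)
  then have "cfrac b bs > 0" by linarith
  then have "cfrac a es > real a" using Cons by simp
  moreover have "real a \<ge> 1" using assms(2) by linarith
  ultimately have "cfrac a es \<noteq> 1" by linarith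
  then show ?thesis using Cons by simp
qed auto

lemma regular_cfrac_expansion_Cons:
  assumes "regular_cfrac_expansion x a (b # bs)"
  shows "x = real a + 1 / cfrac b bs" "cfrac b bs \<ge> 1" "regular_cfrac_expansion (cfrac b bs) b bs"
proof -
  show "x = real a + 1 / cfrac b bs" "regular_cfrac_expansion (cfrac b bs) b bs"
    using assms by (auto simp: regular_cfrac_expansion_def)
  have "b \<ge> 1" "cfrac b bs \<ge> real b"
    using assms by (auto simp: regular_cfrac_expansion_def Suc_le_eq intro!: cfrac_ge)
  then show "cfrac b bs \<ge> 1" by linarith
qed

text \<open>The tail \<open>y\<close> of an arbitrary regular expansion may equal 1; the strict
  bound \<open>1 / x < 1\<close> rules out the resulting carry.\<close>

lemma nat_plus_inverse_eqD:
  fixes x y :: real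
  assumes "real a + 1 / x = real b + 1 / y" "x > 1" "y \<ge> 1"
  shows "b = a \<and> y = x"
proof -
  have x: "0 < 1 / x" "1 / x < 1" and y: "0 < 1 / y" "1 / y \<le> 1" using assms by auto
  have "real a < real b + 1" "real b < real a + 1" using assms(1) x y by linarith+
  then have "a = b" by linarith
  then show ?thesis using assms by auto
qed

text \<open>Because \<open>x > 1\<close>, every expansion of the sum starts with \<open>a\<close>
  and continues with an expansion of \<open>x\<close>, to which the bound 3 applies.\<close>

lemma bounded_cfrac_Cons:
  assumes "bounded_cfrac 3 x" "x > 1" "a \<le> c"
  shows "bounded_cfrac c (real a + 1 / x)"
  unfolding bounded_cfrac_def
proof (intro conjI allI impI)
  obtain b bs where b: "regular_cfrac_expansion x b bs"
    using assms(1) by (auto simp: bounded_cfrac_def)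
  \<comment> \<open>A leading 0 would force \<open>x \<le> 1\<close>, and only a positive entry may
    stand behind \<open>a\<close>.\<close>
  have "b > 0"
  proof (rule ccontr)
    assume "\<not> b > 0"
    then have "b = 0" by simp
    show False
    proof (cases bs)
      case Nil
      then show False using b \<open>b = 0\<close> assms(2) by (simp add: regular_cfrac_expansion_def)
    next
      case (Cons d ds)
      from regular_cfrac_expansion_Cons[OF b[unfolded Cons]] \<open>b = 0\<close>
      have "x \<le> 1" by simp
      then show False using assms(2) by simp
    qed
  qed
  then have "regular_cfrac_expansion (real a + 1 / x) a (b # bs)"
    using b by (auto simp: regular_cfrac_expansion_def)
  then show "\<exists>a' es. regular_cfrac_expansion (real a + 1 / x) a' es" by blast
next
  fix a' es
  assume e: "regular_cfrac_expansion (real a + 1 / x) a' es"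
  have "a' \<le> c \<and> set es \<subseteq> {1, 2, 3}"
  proof (cases es)
    case Nil
    then have "real a + 1 / x = real a'" using e by (simp add: regular_cfrac_expansion_def)
    moreover have "0 < 1 / x" "1 / x < 1" using assms(2) by auto
    ultimately have "a < a'" "a' < a + 1" by linarith+
    then show ?thesis by simp
  next
    case (Cons b bs)
    note E = regular_cfrac_expansion_Cons[OF e[unfolded Cons]]
    from nat_plus_inverse_eqD[OF E(1) assms(2) E(2)]
    have a': "a' = a" and "cfrac b bs = x" by auto
    then have b: "regular_cfrac_expansion x b bs" using E(3) by simp
    then have "b \<le> 3" "set bs \<subseteq> {1, 2, 3}" using assms(1) by (auto simp: bounded_cfrac_def)
    moreover have "b > 0" using e Cons by (simp add: regular_cfrac_expansion_def)
    ultimately have "b \<in> {1, 2, 3}" by auto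
    then show ?thesis using \<open>set bs \<subseteq> {1, 2, 3}\<close> Cons a' assms(3) by simp
  qed
  then show "a' \<le> c" "set es \<subseteq> {1, 2, 3}" by auto
qed

text \<open>The only expansions are \<open>[a]\<close> and, for \<open>a > 0\<close>,
  \<open>[a - 1; 1]\<close>.\<close>

lemma bounded_cfrac_of_nat:
  assumes "a \<le> c"
  shows "bounded_cfrac c (real a)"
  unfolding bounded_cfrac_def
proof (intro conjI allI impI)
  have "regular_cfrac_expansion (real a) a []" by (simp add: regular_cfrac_expansion_def)
  then show "\<exists>a' es. regular_cfrac_expansion (real a) a' es" by blast
next
  fix a' es
  assume e: "regular_cfrac_expansion (real a) a' es"
  have "a' \<le> c \<and> set es \<subseteq> {1, 2, 3}"
  proof (cases es)
    case Nil
    then show ?thesis using e assms by (simp add: regular_cfrac_expansion_def)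
  next
    case (Cons b bs)
    note E = regular_cfrac_expansion_Cons[OF e[unfolded Cons]]
    have inv: "0 < 1 / cfrac b bs" "1 / cfrac b bs \<le> 1" using E(2) by auto
    then have "a' < a" "a \<le> a' + 1" using E(1) by linarith+
    then have "real a = real a' + 1" by linarith
    then have "cfrac b bs = 1" using E(1,2) by (simp add: field_simps)
    then have "b = 1 \<and> bs = []"
      using e Cons by (subst (asm) cfrac_eq_1_iff) (auto simp: regular_cfrac_expansion_def)
    then show ?thesis using \<open>a' < a\<close> assms Cons by simp
  qed
  then show "a' \<le> c" "set es \<subseteq> {1, 2, 3}" by auto
qed

section \<open>The Thue--Morse sequence\<close>

lemma finite_bit_nat: "finite {k. bit (n :: nat) k}"
proof (rule finite_subset)
  show "{k. bit n k} \<subseteq> {..<n}"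
  proof safe
    fix k assume "bit n k"
    then have "n div 2 ^ k \<noteq> 0" by (auto simp: bit_iff_odd intro!: Nat.gr0I)
    then have "2 ^ k \<le> n" by (metis div_less linorder_not_less)
    then show "k < n" using less_exp[of k] by linarith
  qed
qed simp

lemma thue_morse_double: "thue_morse (2 * n) = thue_morse n"
proof -
  have "bit (2 * n) k \<longleftrightarrow> k \<in> Suc ` {k. bit n k}" for k
    by (cases k) (auto simp: bit_0 bit_Suc)
  then have "{k. bit (2 * n) k} = Suc ` {k. bit n k}" by blast
  then show ?thesis
    by (simp add: thue_morse_def binary_digit_sum_def card_image)
qed

lemma thue_morse_double_Suc: "thue_morse (Suc (2 * n)) = - thue_morse n"
proof -
  have "bit (Suc (2 * n)) k \<longleftrightarrow> k \<in> insert 0 (Suc ` {k. bit n k})" for k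
    by (cases k) (auto simp: bit_0 bit_Suc)
  then have "{k. bit (Suc (2 * n)) k} = insert 0 (Suc ` {k. bit n k})" by blast
  then show ?thesis
    by (simp add: thue_morse_def binary_digit_sum_def card_image finite_bit_nat)
qed

lemma thue_morse_cases: "thue_morse n = 1 \<or> thue_morse n = - 1"
  by (auto simp: thue_morse_def minus_one_power_iff)

text \<open>These are the values of \<open>thue_morse\<close> at 1, ..., 15; index 0 is left out
  because the first step from \<open>16 * k\<close> uses the sign at
  \<open>16 * k + 1\<close>.\<close>

definition thue_morse_block :: "int list" where
  "thue_morse_block = [-1, -1, 1, -1, 1, 1, -1, -1, 1, 1, -1, 1, -1, -1, 1]"

lemma thue_morse_0: "thue_morse 0 = 1"
  by (simp add: thue_morse_def binary_digit_sum_def)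

lemma thue_morse_mult_16_plus:
  assumes "j < 15"
  shows "thue_morse (16 * k + Suc j) = thue_morse k * thue_morse_block ! j"
proof -
  have "thue_morse (2 * m + 1) = - thue_morse m" for m
    using thue_morse_double_Suc[of m] by simp
  note tm = this thue_morse_double
  \<comment> \<open>The four lowest binary digits are split off one at a time, so that the doubling
    rules apply.\<close>
  have e: "\<And>b c d. 16 * k + (8 * b + 4 * c + 2 * d) = 2 * (2 * (2 * (2 * k + b) + c) + d)"
    "\<And>b c d. 16 * k + (8 * b + 4 * c + 2 * d + 1) = 2 * (2 * (2 * (2 * k + b) + c) + d) + 1"
    by simp_all
  have t: "thue_morse (2 * m + 0) = thue_morse m" for m by (simp add: thue_morse_double)
  note E = e[of 0 0 0] e[of 0 0 1] e[of 0 1 0] e[of 0 1 1] e[of 1 0 0] e[of 1 0 1] e[of 1 1 0] e[of 1 1 1]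
  have "j \<in> {0, 1, 2, 3, 4, 5, 6, 7, 8, 9, 10, 11, 12, 13, 14}"
    using assms by (simp only: insert_iff empty_iff) presburger
  then show ?thesis
    using E[THEN arg_cong[of _ _ thue_morse], unfolded t tm]
    by (elim insertE emptyE) (simp_all add: thue_morse_block_def eval_nat_numeral)
qed

lemma thue_morse_mult_16: "thue_morse (16 * k) = thue_morse k"
  using thue_morse_double[of "8 * k"] thue_morse_double[of "4 * k"]
    thue_morse_double[of "2 * k"] thue_morse_double[of k] by simp

section \<open>Ratios of consecutive terms\<close>

definition ratio :: "nat \<Rightarrow> real" where
  "ratio n = real_of_int (h n) / real_of_int (h (n - 1))"

text \<open>Division by zero gives 0, so a nonzero ratio certifies that both terms are nonzero and
  that \<open>n > 0\<close>.\<close>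

lemma ratio_Suc:
  assumes "ratio n \<noteq> 0"
  shows "ratio (Suc n) = real_of_int (thue_morse (Suc n)) + 1 / ratio n"
proof -
  obtain m where "n = Suc m" and "h n \<noteq> 0" "h m \<noteq> 0"
    using assms by (cases n) (auto simp: ratio_def)
  then show ?thesis by (simp add: ratio_def add_divide_distrib)
qed

text \<open>The tail is a real number, so an unknown complete quotient can be carried along as a
  single symbol.\<close>

definition cfrac_append :: "nat list \<Rightarrow> real \<Rightarrow> real" where
  "cfrac_append ds V = foldr (\<lambda>a x. real a + 1 / x) ds V"

lemma cfrac_append_simps [simp]:
  "cfrac_append [] V = V"
  "cfrac_append (a # ds) V = real a + 1 / cfrac_append ds V"
  by (simp_all add: cfrac_append_def)

lemma cfrac_append_pos: "V > 0 \<Longrightarrow> cfrac_append ds V > 0"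
  by (induction ds) (auto intro: add_nonneg_pos)

text \<open>
  The map \<open>x \<mapsto> e + 1 / x\<close> for \<open>e \<in> {1, -1}\<close>, where \<open>(\<sigma>, ds)\<close> stands for the number \<open>\<sigma> * [ds, V]\<close>
  with \<open>\<sigma> \<in> {1, -1}\<close>. The inverse of \<open>[0; b, \<dots>]\<close> is \<open>[b; \<dots>]\<close>, so only \<open>b\<close> changes by one;
  for \<open>x = [a; X] > 1\<close> one has \<open>1 - 1 / x = [0; 1, a - 1, X]\<close>, which contracts to \<open>[0; 1 + X]\<close> if \<open>a = 1\<close>.
\<close>

fun prepend :: "int \<Rightarrow> int \<times> nat list \<Rightarrow> int \<times> nat list" where
  "prepend e (\<sigma>, a # ds) =
    (if a = 0 then (\<sigma>, (if e = \<sigma> then hd ds + 1 else hd ds - 1) # tl ds)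
     else if e = \<sigma> then (\<sigma>, 1 # a # ds)
     else if a = 1 then (- \<sigma>, 0 # (hd ds + 1) # tl ds)
     else (- \<sigma>, 0 # 1 # (a - 1) # ds))"
| "prepend e (\<sigma>, []) = (\<sigma>, [])"

text \<open>The last condition ensures that a second entry altered by \<open>prepend\<close> is
  present in the list and not hidden in \<open>V\<close>.\<close>

fun admissible :: "int \<times> nat list \<Rightarrow> bool" where
  "admissible (\<sigma>, a # ds) \<longleftrightarrow>
    \<sigma> \<in> {1, - 1} \<and> a \<le> 4 \<and> set ds \<subseteq> {1, 2, 3} \<and> (a \<le> 1 \<longrightarrow> ds \<noteq> [])"
| "admissible (\<sigma>, []) \<longleftrightarrow> False"

fun state_value :: "real \<Rightarrow> int \<times> nat list \<Rightarrow> real" where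
  "state_value V (\<sigma>, ds) = real_of_int \<sigma> * cfrac_append ds V"

lemma state_value_prepend:
  assumes "admissible p" "V > 0" "e \<in> {1, - 1}"
  shows "state_value V (prepend e p) = real_of_int e + 1 / state_value V p"
proof -
  obtain \<sigma> a ds where p: "p = (\<sigma>, a # ds)"
    using assms(1) by (cases p rule: admissible.cases) auto
  define X where "X = cfrac_append ds V"
  have X: "X > 0" using assms(2) by (simp add: X_def cfrac_append_pos)
  have \<sigma>: "\<sigma> = 1 \<or> \<sigma> = - 1" and e: "e = 1 \<or> e = - 1" using assms p by auto
  show ?thesis
  proof (cases "a \<le> 1")
    case True
    \<comment> \<open>The bound \<open>b \<ge> 1\<close> makes the truncated subtraction in
      \<open>hd ds - 1\<close> exact.\<close>
    then obtain b bs where ds: "ds = b # bs" "b \<ge> 1"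
      using assms(1) p by (cases ds) auto
    define Y where "Y = cfrac_append bs V"
    have Y: "Y > 0" using assms(2) by (simp add: Y_def cfrac_append_pos)
    have XY: "X = real b + 1 / Y" by (simp add: X_def Y_def ds)
    from True have "a = 0 \<or> a = 1" by auto
    then show ?thesis
    proof
      assume "a = 0"
      then show ?thesis using \<sigma> e ds Y X
        by (auto simp: p of_nat_diff simp flip: Y_def)
    next
      assume a: "a = 1"
      have "1 / (1 + X) = 1 - 1 / (1 + 1 / X)" using X by (simp add: field_simps)
      then have "1 / (1 + (real b + 1 / Y)) = 1 - 1 / (1 + 1 / (real b + 1 / Y))"
        by (simp only: XY)
      \<comment> \<open>Reciprocals commute with negation, which reduces \<sigma> = -1 to the
        positive case.\<close>
      moreover have "1 / (- 1 - z) = - (1 / (1 + z))" for z :: real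
        using minus_divide_right[of 1 "1 + z"] by (simp add: algebra_simps)
      ultimately show ?thesis using \<sigma> e a ds
        by (auto simp: p add.assoc simp flip: Y_def)
    qed
  next
    case False
    then have "real a - 1 > 0" by simp
    then have "real a - 1 + 1 / X > 0" using X by (simp add: add_pos_pos)
    then have "1 / (1 + 1 / (real a - 1 + 1 / X)) = 1 - 1 / (real a + 1 / X)"
      using X False by (simp add: divide_simps) (simp add: algebra_simps)
    moreover have "1 / (- real a - z) = - (1 / (real a + z))" for z :: real
      using minus_divide_right[of 1 "real a + z"] by (simp add: algebra_simps)
    ultimately show ?thesis using False \<sigma> e
      by (auto simp: p of_nat_diff simp flip: X_def)
  qed
qed

lemma bounded_cfrac_append_tail:
  assumes "set ds \<subseteq> {1, 2, 3}" "bounded_cfrac 3 V" "V > 1"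
  shows "bounded_cfrac 3 (cfrac_append ds V)" "cfrac_append ds V > 1"
proof -
  have "bounded_cfrac 3 (cfrac_append ds V) \<and> cfrac_append ds V > 1"
    using assms(1)
  proof (induction ds)
    case (Cons b ds)
    then have IH: "bounded_cfrac 3 (cfrac_append ds V)" "cfrac_append ds V > 1" by auto
    have "b \<le> 3" "real b \<ge> 1" using Cons.prems by auto
    moreover have "1 / cfrac_append ds V > 0" using IH(2) by simp
    ultimately have "real b + 1 / cfrac_append ds V > 1" by linarith
    then show ?case using bounded_cfrac_Cons[OF IH \<open>b \<le> 3\<close>] by simp
  qed (use assms in simp)
  then show "bounded_cfrac 3 (cfrac_append ds V)" "cfrac_append ds V > 1" by auto
qed

lemma bounded_cfrac_append:
  assumes "admissible (\<sigma>, ds)" "bounded_cfrac 3 V" "V > 1"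
  shows "bounded_cfrac 4 (cfrac_append ds V)"
proof -
  obtain a es where "ds = a # es" "a \<le> 4" "set es \<subseteq> {1, 2, 3}"
    using assms(1) by (cases ds) auto
  then show ?thesis
    using bounded_cfrac_Cons[OF bounded_cfrac_append_tail[OF _ assms(2,3)]] by simp
qed

text \<open>Only signs and lists of naturals occur here, so an explicit run is decided by
  simplification, uniformly in the tail.\<close>

fun admissible_run :: "int list \<Rightarrow> int \<times> nat list \<Rightarrow> bool" where
  "admissible_run [] p \<longleftrightarrow> admissible p"
| "admissible_run (e # es) p \<longleftrightarrow> e \<in> {1, - 1} \<and> admissible p \<and> admissible_run es (prepend e p)"

definition bounded_ratio :: "nat \<Rightarrow> bool" where
  "bounded_ratio n \<longleftrightarrow> ratio n \<noteq> 0 \<and> bounded_cfrac 4 \<bar>ratio n\<bar>"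

text \<open>For \<open>s\<close> in {1, -1} one has
  \<open>s * e + 1 / (s * x) = s * (e + 1 / x)\<close>, so a common sign factors out of the whole
  run.\<close>

lemma admissible_run:
  assumes "admissible_run es p" "bounded_cfrac 3 V" "V > 1" "s \<in> {1, - 1}"
    "ratio n = real_of_int s * state_value V p"
    "\<And>j. j < length es \<Longrightarrow> thue_morse (n + Suc j) = s * es ! j"
  shows "(\<forall>j\<le>length es. bounded_ratio (n + j)) \<and>
    ratio (n + length es) = real_of_int s * state_value V (fold prepend es p)"
  using assms(1,5,6)
proof (induction es arbitrary: p n)
  case Nil
  obtain \<sigma> ds where p: "p = (\<sigma>, ds)" by force
  have adm: "admissible (\<sigma>, ds)" using Nil p by simp
  then have \<sigma>: "\<sigma> = 1 \<or> \<sigma> = - 1" by (cases ds) auto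
  have pos: "cfrac_append ds V > 0" using assms(3) by (intro cfrac_append_pos) simp
  have "\<bar>ratio n\<bar> = cfrac_append ds V" using Nil(2) p \<sigma> assms(4) pos by auto
  then show ?case using Nil(2) p bounded_cfrac_append[OF adm assms(2,3)] pos
    by (auto simp: bounded_ratio_def)
next
  case (Cons e es)
  have e: "e \<in> {1, - 1}" and adm: "admissible p" and run: "admissible_run es (prepend e p)"
    using Cons.prems(1) by auto
  obtain \<sigma> ds where p: "p = (\<sigma>, ds)" by force
  have \<sigma>: "\<sigma> = 1 \<or> \<sigma> = - 1" using adm p by (cases ds) auto
  have pos: "cfrac_append ds V > 0" using assms(3) by (intro cfrac_append_pos) simp
  have "\<bar>ratio n\<bar> = cfrac_append ds V" using Cons.prems(2) p \<sigma> assms(4) pos by auto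
  then have nz: "ratio n \<noteq> 0" and good: "bounded_ratio n"
    using pos bounded_cfrac_append[OF adm[unfolded p] assms(2,3)] by (auto simp: bounded_ratio_def)
  have "ratio (Suc n) = real_of_int (s * e) + 1 / (real_of_int s * state_value V p)"
    using ratio_Suc[OF nz] Cons.prems(2) Cons.prems(3)[of 0] by simp
  also have "\<dots> = real_of_int s * (real_of_int e + 1 / state_value V p)"
    using assms(4) by auto
  also have "\<dots> = real_of_int s * state_value V (prepend e p)"
    using state_value_prepend[OF adm _ e] assms(3) by simp
  finally have "(\<forall>j\<le>length es. bounded_ratio (Suc n + j)) \<and>
    ratio (Suc n + length es) = real_of_int s * state_value V (fold prepend es (prepend e p))"
    using Cons.prems(3)[of "Suc _"] by (intro Cons.IH run) auto
  then have run: "\<And>j. j \<le> length es \<Longrightarrow> bounded_ratio (Suc n + j)"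
    and last: "ratio (n + length (e # es)) = real_of_int s * state_value V (fold prepend (e # es) p)"
    by auto
  have "bounded_ratio (n + j)" if "j \<le> length (e # es)" for j
    using that good run[of "j - 1"] by (cases j) auto
  then show ?case using last by blast
qed

section \<open>Blocks of sixteen steps\<close>

definition block_start :: "nat \<Rightarrow> bool" where
  "block_start k \<longleftrightarrow> (\<exists>V p. bounded_cfrac 3 V \<and> V > 1 \<and> p \<in> {(1, [4]), (- 1, [2])} \<and>
    ratio (16 * k) = real_of_int (thue_morse k) * state_value V p)"

text \<open>The entries behind the leading one are absorbed into a new tail, so each block starts
  with one explicit entry.\<close>

lemma block_startI:
  assumes "ratio (16 * k) = real_of_int (thue_morse k) * state_value V (\<sigma>, a # ds)"
    "(\<sigma>, a) \<in> {(1, 4), (- 1, 2)}" "set ds \<subseteq> {1, 2, 3}" "bounded_cfrac 3 V" "V > 1"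
  shows "block_start k"
proof -
  have "state_value V (\<sigma>, a # ds) = state_value (cfrac_append ds V) (\<sigma>, [a])" by simp
  then show ?thesis
    unfolding block_start_def using assms bounded_cfrac_append_tail[OF assms(3-5)]
    by (intro exI[of _ "cfrac_append ds V"] exI[of _ "(\<sigma>, [a])"]) auto
qed

lemma block:
  assumes "block_start k"
  shows "j \<le> 16 \<Longrightarrow> bounded_ratio (16 * k + j)" "block_start (Suc k)"
proof -
  obtain V p where V: "bounded_cfrac 3 V" "V > 1" and p: "p \<in> {(1, [4]), (- 1, [2])}"
    and start: "ratio (16 * k) = real_of_int (thue_morse k) * state_value V p"
    using assms unfolding block_start_def by blast
  \<comment> \<open>The sixteenth sign is that of \<open>Suc k\<close>; factoring out
    \<open>thue_morse k\<close> leaves \<open>e\<close>.\<close>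
  define e where "e = thue_morse k * thue_morse (Suc k)"
  have k: "thue_morse k \<in> {1, - 1}" and e: "e \<in> {1, - 1}"
    using thue_morse_cases[of k] thue_morse_cases[of "Suc k"] by (auto simp: e_def)
  define es where "es = thue_morse_block @ [e]"
  have [simp]: "length es = 16" by (simp add: es_def thue_morse_block_def)
  have letters: "thue_morse (16 * k + Suc j) = thue_morse k * es ! j" if "j < length es" for j
  proof (cases "j < 15")
    case True
    have "es ! j = thue_morse_block ! j"
      unfolding es_def by (subst nth_append) (use True in \<open>simp add: thue_morse_block_def\<close>)
    then show ?thesis using thue_morse_mult_16_plus[OF True, of k] by simp
  next
    case False
    then have "j = 15" using that by simp
    then show ?thesis using k thue_morse_mult_16[of "Suc k"]
      by (auto simp: es_def nth_append thue_morse_block_def e_def add.commute)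
  qed
  have "admissible_run es p" using p e
    by (auto simp: es_def thue_morse_block_def)
  from admissible_run[OF this V k start letters]
  have run: "\<And>j. j \<le> 16 \<Longrightarrow> bounded_ratio (16 * k + j)"
    and last: "ratio (16 * Suc k) = real_of_int (thue_morse k) * state_value V (fold prepend es p)"
    by (auto simp: add.commute)
  show "j \<le> 16 \<Longrightarrow> bounded_ratio (16 * k + j)" by (rule run)
  \<comment> \<open>From both starts the fifteen fixed signs lead to
    \<open>(1, 0 # 3 # ...)\<close>; the sign \<open>e\<close> then turns the 3 into 4 or 2.\<close>
  have "\<exists>a ds. fold prepend es p = (1, a # ds) \<and> (e, a) \<in> {(1, 4), (- 1, 2)} \<and> set ds \<subseteq> {1, 2, 3}"
    using p e by (auto simp: es_def thue_morse_block_def)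
  then obtain a ds where fold: "fold prepend es p = (1, a # ds)"
    and a: "(e, a) \<in> {(1, 4), (- 1, 2)}" and ds: "set ds \<subseteq> {1, 2, 3}" by blast
  have "thue_morse k = thue_morse (Suc k) * e"
    using thue_morse_cases[of "Suc k"] by (auto simp: e_def)
  then have "ratio (16 * Suc k) = real_of_int (thue_morse (Suc k)) * state_value V (e, a # ds)"
    using last by (simp add: fold)
  then show "block_start (Suc k)" by (rule block_startI[OF _ a ds V])
qed

section \<open>Initial values and conclusion\<close>

lemma h_values: "h 4 = -1 \<and> h 5 = - 1 \<and> h 6 = -2 \<and> h 7 = 1 \<and> h 8 = - 3 \<and> h 9 = - 2"
proof -
  have "thue_morse 1 = -1" using thue_morse_double_Suc[of 0] thue_morse_0 by simp
  then have "thue_morse 1 = -1" "thue_morse 2 = -1" "thue_morse 3 = 1" "thue_morse 4 = -1"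
    "thue_morse 5 = 1" "thue_morse 6 = 1" "thue_morse 7 = -1" "thue_morse 8 = -1"  "thue_morse 9 = 1"
    using thue_morse_double[of 1] thue_morse_double[of 2] thue_morse_double[of 3] thue_morse_double[of 4]
      thue_morse_double_Suc[of 1] thue_morse_double_Suc[of 2] thue_morse_double_Suc[of 3] thue_morse_double_Suc[of 4]
    by (simp_all add: eval_nat_numeral)
  then show ?thesis by (simp add: eval_nat_numeral)
qed

lemma initial_ratios: "n \<in> {5..16} \<Longrightarrow> bounded_ratio n" "block_start 1"
proof -
  have two: "bounded_cfrac 3 2" using bounded_cfrac_of_nat[of 2 3] by simp
  have V: "(2 :: real) > 1" by simp
  \<comment> \<open>The signs at 10, ..., 16.\<close>
  define es where "es = drop 9 thue_morse_block @ [- 1]"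
  \<comment> \<open>The ratio at 9 is 2/3 = [0; 1, 2], whose last entry 2 serves as the
    tail.\<close>
  define p :: "int \<times> nat list" where "p = (1, [0, 1])"
  have [simp]: "length es = 7" by (simp add: es_def thue_morse_block_def)
  have "ratio 9 = real_of_int 1 * state_value 2 p"
    using h_values by (simp add: ratio_def p_def)
  moreover have "thue_morse (9 + Suc j) = 1 * es ! j" if "j < length es" for j
  proof (cases "j < 6")
    case True
    have "es ! j = thue_morse_block ! (9 + j)"
      unfolding es_def by (subst nth_append) (use True in \<open>simp add: thue_morse_block_def\<close>)
    then show ?thesis
      using thue_morse_mult_16_plus[of "9 + j" 0] True
      by (simp add: thue_morse_0)
  next
    case False
    then have "j = 6" using that by simp
    then show ?thesis
      using thue_morse_mult_16[of 1] thue_morse_double_Suc[of 0]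
      by (simp add: es_def nth_append thue_morse_block_def thue_morse_0)
  qed
  moreover have "admissible_run es p" by (simp add: es_def p_def thue_morse_block_def)
  ultimately have run: "\<And>j. j \<le> 7 \<Longrightarrow> bounded_ratio (9 + j)"
    and last: "ratio 16 = real_of_int 1 * state_value 2 (fold prepend es p)"
    using admissible_run[of es p 2 1 9] two by auto
  have "fold prepend es p = (1, [2])" by (simp add: es_def p_def thue_morse_block_def)
  \<comment> \<open>Since \<open>thue_morse 1\<close> is -1, factoring it out turns [2; 2] into
    -[2; 2].\<close>
  then have "ratio (16 * 1) = real_of_int (thue_morse 1) * state_value 2 (- 1, [2])"
    using last thue_morse_double_Suc[of 0] by (simp add: thue_morse_0)
  then show "block_start 1" by (rule block_startI[OF _ _ _ two]) auto
  \<comment> \<open>The absolute ratios at 5, 6, 7, 8 are 1, 2, 1/2 = [0; 2] and 3.\<close>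
  have "bounded_ratio 5" "bounded_ratio 6" "bounded_ratio 8"
    using h_values bounded_cfrac_of_nat[of 1 4] bounded_cfrac_of_nat[of 2 4] bounded_cfrac_of_nat[of 3 4]
    by (simp_all add: bounded_ratio_def ratio_def)
  moreover have "bounded_ratio 7"
    using h_values bounded_cfrac_Cons[OF two V, of 0 4] by (simp add: bounded_ratio_def ratio_def)
  moreover assume "n \<in> {5..16}"
  then have "n = 5 \<or> n = 6 \<or> n = 7 \<or> n = 8 \<or> n \<ge> 9 \<and> n \<le> 16" by auto
  ultimately show "bounded_ratio n" using run[of "n - 9"] by auto
qed

lemma block_start_pos: "k \<ge> 1 \<Longrightarrow> block_start k"
  by (induction k rule: dec_induct) (use initial_ratios block in auto)

lemma bounded_ratio:
  assumes "n \<ge> 5"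
  shows "bounded_ratio n"
proof (cases "n \<le> 16")
  case True
  then show ?thesis using assms by (intro initial_ratios) simp
next
  case False
  then have "block_start (n div 16)" by (intro block_start_pos) simp
  from block(1)[OF this, of "n mod 16"] show ?thesis
    by simp
qed

theorem theorem5:
  fixes n :: nat
  assumes "n \<ge> 5"
  shows "h (n - 1) \<noteq> 0 \<and>
    (let x = \<bar>real_of_int (h n)\<bar> / \<bar>real_of_int (h (n - 1))\<bar> in
      (\<exists>a es. regular_cfrac_expansion x a es) \<and>
      (\<forall>a es. regular_cfrac_expansion x a es \<longrightarrow>
        a \<in> {0, 1, 2, 3, 4} \<and> (\<forall>e\<in>set es. e \<in> {1, 2, 3})))"
proof -
  have b: "bounded_ratio n" using assms by (rule bounded_ratio)
  \<comment> \<open>A zero denominator would make the ratio 0.\<close>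
  then have nz: "h (n - 1) \<noteq> 0" by (auto simp: bounded_ratio_def ratio_def)
  have "a \<in> {0, 1, 2, 3, 4}" if "a \<le> 4" for a :: nat using that by auto
  with b nz show ?thesis
    unfolding bounded_ratio_def bounded_cfrac_def ratio_def abs_divide Let_def by blast
qed

end
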